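(* Let $(X,d)$ be a complete $b$-metric space with parameter $b\geq 1$, let $k$ be a positive integer, and let $f:X^{k}\rightarrow X$ be a mapping. Suppose that there exists a constant $a\in\mathbb{R}$ such that $0\leq a k b^{k+1}<1$ and $$d(f(x_{1},\ldots,x_{k}),f(x_{2},\ldots,x_{k+1}))\leq a\max_{1\leq i\leq k+1}\{d(x_{i},f(x_{i},\ldots,x_{i}))\}$$ for all $(x_{1},\ldots,x_{k+1})\in X^{k+1}$. Then: (i) $f$ has a unique fixed point $u\in X$, that is, a unique $u\in X$ with $f(u,\ldots,u)=u$; (ii) for any points $x_{1},\ldots,x_{k}\in X$, the sequence $\{x_{n}\}_{n\geq 1}$ defined by $x_{n+k}=f(x_{n},\ldots,x_{n+k-1})$, $n=1,2,\ldots$, converges to $u$.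
   Context: For a nonempty set $X$ and a real $b\geq 1$, a map $d:X\times X\to[0,\infty)$ is a $b$-metric on $X$ (and $(X,d)$ is a $b$-metric space with parameter $b$) if for all $x,y,z\in X$: $d(x,y)=0$ if and only if $x=y$; $d(x,y)=d(y,x)$; and $d(x,y)\leq b\,(d(x,z)+d(z,y))$. A sequence $\{x_n\}$ in $X$ is Cauchy if for every $\varepsilon>0$ there is a positive integer $N$ with $d(x_n,x_m)<\varepsilon$ for all $n,m\geq N$; it converges to $x\in X$ if $\lim_{n\to\infty}d(x_n,x)=0$. $(X,d)$ is complete if every Cauchy sequence in $X$ converges to an element of $X$. A fixed point of $f:X^k\to X$ is a point $x^{*}\in X$ with $f(x^{*},\ldots,x^{*})=x^{*}$. *)

theory Defs
  imports Complex_Main "HOL-Library.FuncSet"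
begin

locale b_metric_space =
  fixes X :: "'a set" and d :: "'a \<Rightarrow> 'a \<Rightarrow> real" and b :: real
  assumes nonempty: "X \<noteq> {}"
    and param_ge_1: "1 \<le> b"
    and nonneg: "\<lbrakk>x \<in> X; y \<in> X\<rbrakk> \<Longrightarrow> 0 \<le> d x y"
    and zero_iff: "\<lbrakk>x \<in> X; y \<in> X\<rbrakk> \<Longrightarrow> d x y = 0 \<longleftrightarrow> x = y"
    and commute: "\<lbrakk>x \<in> X; y \<in> X\<rbrakk> \<Longrightarrow> d x y = d y x"
    and b_triangle: "\<lbrakk>x \<in> X; y \<in> X; z \<in> X\<rbrakk> \<Longrightarrow> d x y \<le> b * (d x z + d z y)"

(* Sequences are indexed by n \<ge> 1; the value at index 0 is irrelevant. *)

definition b_Cauchy :: "('a \<Rightarrow> 'a \<Rightarrow> real) \<Rightarrow> (nat \<Rightarrow> 'a) \<Rightarrow> bool" where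
  "b_Cauchy d x \<longleftrightarrow> (\<forall>\<epsilon>>0. \<exists>N\<ge>1. \<forall>n\<ge>N. \<forall>m\<ge>N. d (x n) (x m) < \<epsilon>)"

definition b_converges :: "('a \<Rightarrow> 'a \<Rightarrow> real) \<Rightarrow> (nat \<Rightarrow> 'a) \<Rightarrow> 'a \<Rightarrow> bool" where
  "b_converges d x l \<longleftrightarrow> (\<lambda>n. d (x n) l) \<longlonglongrightarrow> 0"

definition b_complete :: "'a set \<Rightarrow> ('a \<Rightarrow> 'a \<Rightarrow> real) \<Rightarrow> bool" where
  "b_complete X d \<longleftrightarrow>
     (\<forall>x. (\<forall>n\<ge>1. x n \<in> X) \<and> b_Cauchy d x \<longrightarrow> (\<exists>l\<in>X. b_converges d x l))"

(* X^k is represented by the lists of length k over X, so the i-th coordinate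
   of a tuple xs, counted from 1, is xs ! (i - 1). *)
definition tuples :: "'a set \<Rightarrow> nat \<Rightarrow> 'a list set" where
  "tuples X k = {xs. length xs = k \<and> set xs \<subseteq> X}"

definition fixed_point :: "'a set \<Rightarrow> nat \<Rightarrow> ('a list \<Rightarrow> 'a) \<Rightarrow> 'a \<Rightarrow> bool" where
  "fixed_point X k f u \<longleftrightarrow> u \<in> X \<and> f (replicate k u) = u"

end

theory Submission
  imports Defs
begin

text \<open>
  Write \<open>F x = f (x, \<dots>, x)\<close> and call \<open>D x = d x (F x)\<close> the defect of \<open>x\<close>; fixed points of \<open>f\<close>
  are the points of defect \<open>0\<close>.  Any two \<open>k\<close>-tuples \<open>p\<close> and \<open>q\<close> are joined by the \<open>k + 1\<close>
  windows of length \<open>k\<close> of the concatenation \<open>p @ q\<close>.  Consecutive windows are of the form to which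
  the contraction hypothesis applies, so \<open>k\<close> uses of it and the relaxed triangle inequality give
  \<open>d (f p) (f q) \<le> L * M\<close> with \<open>L = a * k * b ^ (k - 1)\<close> whenever \<open>M\<close> bounds the defects of all
  entries of \<open>p\<close> and \<open>q\<close> (lemma \<open>image_dist_le\<close>).  The hypothesis on \<open>a\<close> says \<open>L * b\<^sup>2 < 1\<close>;
  in particular \<open>L < 1\<close> and \<open>b * L < 1\<close>.

  Everything follows from this estimate.  Uniqueness is the case \<open>M = 0\<close>.  Along
  the Picard iterates of \<open>F\<close> the defect decays geometrically with ratio \<open>L\<close>.  If the defects of
  some sequence \<open>x\<close> in \<open>X\<close> tend to \<open>0\<close>, then \<open>F (x n)\<close> is Cauchy, and its limit \<open>u\<close> satisfies
  \<open>D u \<le> b * L * D u\<close>, so \<open>u\<close> is a fixed point.  For a sequence with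
  \<open>x (n + k) = f (x n, \<dots>, x (n + k - 1))\<close>, comparing this tuple with the constant tuple at
  \<open>x (n + k)\<close> shows that \<open>D (x (n + k))\<close> is at most \<open>L\<close> times the largest of the \<open>k\<close> preceding
  defects, so the defects again tend to \<open>0\<close>; comparing it with the constant tuple at the fixed point
  \<open>u\<close> bounds \<open>d (x (n + k)) u\<close> by \<open>L\<close> times the largest defect in the tuple.
\<close>

section \<open>Chains in a b-metric space\<close>

lemma (in b_metric_space) chain_dist_le:
  assumes "\<And>i. i \<le> Suc n \<Longrightarrow> z i \<in> X"
    and "\<And>i. i \<le> n \<Longrightarrow> d (z i) (z (Suc i)) \<le> e"
  shows "d (z 0) (z (Suc n)) \<le> real (Suc n) * b ^ n * e"
  using assms
proof (induction n)
  case 0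
  then show ?case by simp
next
  case (Suc n)
  have X: "z 0 \<in> X" "z (Suc n) \<in> X" "z (Suc (Suc n)) \<in> X"
    using Suc.prems(1) by auto
  have step: "d (z (Suc n)) (z (Suc (Suc n))) \<le> e"
    using Suc.prems(2) by simp
  have e: "0 \<le> e"
    using nonneg[OF X(2,3)] step by linarith
  have IH: "d (z 0) (z (Suc n)) \<le> real (Suc n) * b ^ n * e"
    using Suc.prems by (intro Suc.IH) auto
  have "1 \<le> b ^ n"
    using param_ge_1 by simp
  then have "e \<le> b ^ n * e"
    using e mult_right_mono by fastforce
  then have "d (z 0) (z (Suc n)) + d (z (Suc n)) (z (Suc (Suc n)))
      \<le> real (Suc n) * b ^ n * e + b ^ n * e"
    using IH step by linarith
  then have "b * (d (z 0) (z (Suc n)) + d (z (Suc n)) (z (Suc (Suc n))))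
      \<le> b * (real (Suc n) * b ^ n * e + b ^ n * e)"
    using param_ge_1 by (intro mult_left_mono) auto
  also have "\<dots> = real (Suc (Suc n)) * b ^ Suc n * e"
    by (simp add: algebra_simps)
  finally show ?case
    using b_triangle[OF X(1,3,2)] by linarith
qed

section \<open>Comparing the images of two tuples\<close>

lemma replicate_in_tuples: "x \<in> X \<Longrightarrow> replicate k x \<in> tuples X k"
  by (auto simp: tuples_def)

text \<open>
  The setting of the theorem, with the maximum in the contraction hypothesis replaced by an arbitrary
  upper bound of the defects.
\<close>

locale presic_kannan_map = b_metric_space X d b
  for X :: "'a set" and d :: "'a \<Rightarrow> 'a \<Rightarrow> real" and b :: real +
  fixes k :: nat and a :: real and f :: "'a list \<Rightarrow> 'a"
  assumes k_ge_1: "1 \<le> k"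
    and maps: "f \<in> tuples X k \<rightarrow> X"
    and a_nonneg: "0 \<le> a"
    and a_less: "a * real k * b ^ (k + 1) < 1"
    and contraction: "\<lbrakk>xs \<in> tuples X (k + 1); \<And>y. y \<in> set xs \<Longrightarrow> d y (f (replicate k y)) \<le> M\<rbrakk>
      \<Longrightarrow> d (f (take k xs)) (f (drop 1 xs)) \<le> a * M"
begin

text \<open>The restriction of \<open>f\<close> to the diagonal of \<open>X\<^sup>k\<close>.\<close>

definition diag :: "'a \<Rightarrow> 'a" where
  "diag x = f (replicate k x)"

text \<open>The distance by which a point fails to be a fixed point.\<close>

definition defect :: "'a \<Rightarrow> real" where
  "defect x = d x (diag x)"

text \<open>
  The contraction constant for arbitrary pairs of \<open>k\<close>-tuples. The \<open>k\<close> steps of the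
  chain of windows cost only \<open>k - 1\<close> factors \<open>b\<close>.
\<close>

definition ratio :: real where
  "ratio = a * real k * b ^ (k - 1)"

lemma f_in: "xs \<in> tuples X k \<Longrightarrow> f xs \<in> X"
  using maps by auto

lemma diag_in: "x \<in> X \<Longrightarrow> diag x \<in> X"
  unfolding diag_def by (intro f_in replicate_in_tuples)

lemma defect_nonneg: "x \<in> X \<Longrightarrow> 0 \<le> defect x"
  unfolding defect_def by (intro nonneg diag_in)

lemma fixed_point_iff: "fixed_point X k f u \<longleftrightarrow> u \<in> X \<and> defect u = 0"
  using zero_iff[of u "diag u"] diag_in[of u]
  by (auto simp: fixed_point_def defect_def diag_def)

lemma ratio_nonneg: "0 \<le> ratio"
  unfolding ratio_def using a_nonneg param_ge_1 by simp

lemma b_ratio_less_1: "b * ratio < 1"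
proof -
  have "b * ratio \<le> b * (b * ratio)"
    using param_ge_1 ratio_nonneg mult_right_mono[of 1 b "b * ratio"] by simp
  also have "b * (b * ratio) = a * real k * b ^ (k + 1)"
    unfolding ratio_def using k_ge_1 by (cases k) auto
  finally show ?thesis
    using a_less by simp
qed

lemma ratio_less_1: "ratio < 1"
  using b_ratio_less_1 param_ge_1 ratio_nonneg mult_right_mono[of 1 b ratio] by simp

lemma image_dist_le:
  assumes p: "p \<in> tuples X k" and q: "q \<in> tuples X k"
    and M: "\<And>y. y \<in> set p \<union> set q \<Longrightarrow> defect y \<le> M"
  shows "d (f p) (f q) \<le> ratio * M"
proof -
  define w where "w i = take k (drop i (p @ q))" for i
  have len: "length p = k" "length q = k" and sub: "set p \<subseteq> X" "set q \<subseteq> X"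
    using p q by (auto simp: tuples_def)
  obtain n where n: "k = Suc n"
    using k_ge_1 by (cases k) auto
  have w_in: "w i \<in> tuples X k" if "i \<le> k" for i
    using that len sub set_take_subset[of k "drop i (p @ q)"] set_drop_subset[of i "p @ q"]
    by (auto simp: w_def tuples_def simp del: drop_append take_append)
  have step: "d (f (w i)) (f (w (Suc i))) \<le> a * M" if "i \<le> n" for i
  proof -
    \<comment> \<open>Two consecutive windows are the initial and final parts of one window of length \<open>k + 1\<close>.\<close>
    define v where "v = take (k + 1) (drop i (p @ q))"
    have v_set: "set v \<subseteq> set p \<union> set q"
      using set_take_subset[of "k + 1" "drop i (p @ q)"] set_drop_subset[of i "p @ q"]
      unfolding v_def set_append by blast
    have v: "v \<in> tuples X (k + 1)"
      using that n len sub v_set by (auto simp: v_def tuples_def)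
    have "take k v = w i" "drop 1 v = w (Suc i)"
      by (simp_all add: v_def w_def drop_take min_def del: drop_append take_append)
    moreover have "d (f (take k v)) (f (drop 1 v)) \<le> a * M"
      using v v_set M by (intro contraction) (auto simp: defect_def diag_def)
    ultimately show ?thesis by simp
  qed
  have "d (f (w 0)) (f (w (Suc n))) \<le> real (Suc n) * b ^ n * (a * M)"
    using w_in step n by (intro chain_dist_le) (auto intro: f_in)
  moreover have "w 0 = p" "w (Suc n) = q"
    using len n by (simp_all add: w_def)
  ultimately show ?thesis
    unfolding ratio_def using n by (simp add: ac_simps)
qed

lemma diag_dist_le:
  assumes "x \<in> X" "y \<in> X"
  shows "d (diag x) (diag y) \<le> ratio * max (defect x) (defect y)"
  unfolding diag_def
  using assms by (intro image_dist_le replicate_in_tuples) (auto split: if_splits)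

section \<open>Existence and uniqueness of the fixed point\<close>

lemma fixed_point_unique:
  assumes "fixed_point X k f u" "fixed_point X k f v"
  shows "u = v"
proof -
  have "diag u = u" "diag v = v"
    using assms by (simp_all add: fixed_point_def diag_def)
  moreover have "defect u = 0" "defect v = 0" and X: "u \<in> X" "v \<in> X"
    using assms by (simp_all add: fixed_point_iff)
  ultimately have "d u v \<le> 0"
    using diag_dist_le[OF X] by simp
  then show ?thesis
    using nonneg[OF X] zero_iff[OF X] by simp
qed

text \<open>
  Estimates of a defect by \<open>image_dist_le\<close> have that same defect on the right-hand side; since
  \<open>ratio < 1\<close>, it can be dropped there.
\<close>

lemma absorb_max:
  assumes "t \<le> ratio * max C t" "0 \<le> C"
  shows "t \<le> ratio * C"
proof (cases "t \<le> C")
  case False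
  have "(1 - ratio) * t \<le> 0"
    using assms False by (simp add: max_def algebra_simps)
  then have "t \<le> 0"
    using ratio_less_1 by (simp add: mult_le_0_iff)
  then show ?thesis
    using False assms(2) by simp
qed (use assms in \<open>simp add: max_def\<close>)

lemma ratio_power_tendsto_0: "(\<lambda>n. ratio ^ n * C) \<longlonglongrightarrow> 0"
  using ratio_nonneg ratio_less_1 by (intro tendsto_mult_left_zero LIMSEQ_realpow_zero)

lemma picard_defect_tendsto_0:
  assumes "x \<in> X"
  shows "(diag ^^ n) x \<in> X" and "(\<lambda>n. defect ((diag ^^ n) x)) \<longlonglongrightarrow> 0"
proof -
  show X: "(diag ^^ n) x \<in> X" for n
    by (induction n) (auto simp: assms diag_in)
  have "defect ((diag ^^ n) x) \<le> ratio ^ n * defect x" for n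
  proof (induction n)
    case (Suc n)
    let ?y = "(diag ^^ n) x"
    have "defect (diag ?y) \<le> ratio * max (defect ?y) (defect (diag ?y))"
      using diag_dist_le[OF X[of n] diag_in[OF X[of n]]] by (simp add: defect_def)
    then have "defect (diag ?y) \<le> ratio * defect ?y"
      by (rule absorb_max) (rule defect_nonneg[OF X])
    also have "\<dots> \<le> ratio * (ratio ^ n * defect x)"
      using Suc.IH ratio_nonneg by (rule mult_left_mono)
    finally show ?case by (simp add: mult.assoc)
  qed simp
  then show "(\<lambda>n. defect ((diag ^^ n) x)) \<longlonglongrightarrow> 0"
    using defect_nonneg[OF X]
    by (intro tendsto_sandwich[OF _ _ tendsto_const ratio_power_tendsto_0[of "defect x"]]) auto
qed

lemma fixed_point_exists_if_defect_tendsto_0: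
  assumes complete: "b_complete X d"
    and X: "\<And>n. x n \<in> X" and lim: "(\<lambda>n. defect (x n)) \<longlonglongrightarrow> 0"
  shows "\<exists>u. fixed_point X k f u"
proof -
  have "b_Cauchy d (\<lambda>n. diag (x n))"
    unfolding b_Cauchy_def
  proof (intro allI impI)
    fix e :: real assume e: "0 < e"
    obtain N where N: "\<And>n. n \<ge> N \<Longrightarrow> defect (x n) < e"
      using order_tendstoD(2)[OF lim e] by (auto simp: eventually_sequentially)
    have "d (diag (x n)) (diag (x m)) < e" if "n \<ge> N" "m \<ge> N" for n m
    proof -
      have "d (diag (x n)) (diag (x m)) \<le> ratio * max (defect (x n)) (defect (x m))"
        by (intro diag_dist_le X)
      also have "\<dots> \<le> ratio * e"
        using N[OF that(1)] N[OF that(2)] ratio_nonneg by (intro mult_left_mono) auto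
      also have "\<dots> < e"
        using e ratio_less_1 by simp
      finally show ?thesis .
    qed
    then show "\<exists>N\<ge>1. \<forall>n\<ge>N. \<forall>m\<ge>N. d (diag (x n)) (diag (x m)) < e"
      by (intro exI[of _ "max 1 N"]) auto
  qed
  moreover have "\<forall>n\<ge>1. diag (x n) \<in> X"
    using X diag_in by simp
  ultimately have "\<exists>u\<in>X. b_converges d (\<lambda>n. diag (x n)) u"
    using complete[unfolded b_complete_def, THEN spec[of _ "\<lambda>n. diag (x n)"]] by simp
  then obtain u where u: "u \<in> X" and conv: "(\<lambda>n. d (diag (x n)) u) \<longlonglongrightarrow> 0"
    unfolding b_converges_def by (elim bexE)
  have "defect u \<le> b * (d (diag (x n)) u + ratio * (defect u + defect (x n)))" for n
  proof -
    have "d (diag (x n)) (diag u) \<le> ratio * max (defect (x n)) (defect u)"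
      by (intro diag_dist_le X u)
    also have "\<dots> \<le> ratio * (defect u + defect (x n))"
      using ratio_nonneg defect_nonneg[OF u] defect_nonneg[OF X[of n]]
      by (intro mult_left_mono) auto
    finally have "d u (diag (x n)) + d (diag (x n)) (diag u)
        \<le> d (diag (x n)) u + ratio * (defect u + defect (x n))"
      using commute[OF u diag_in[OF X[of n]]] by simp
    then have "b * (d u (diag (x n)) + d (diag (x n)) (diag u))
        \<le> b * (d (diag (x n)) u + ratio * (defect u + defect (x n)))"
      using param_ge_1 by (intro mult_left_mono) auto
    then show ?thesis
      using b_triangle[OF u diag_in[OF u] diag_in[OF X[of n]]] by (simp add: defect_def)
  qed
  moreover have "(\<lambda>n. b * (d (diag (x n)) u + ratio * (defect u + defect (x n))))
      \<longlonglongrightarrow> b * (0 + ratio * (defect u + 0))"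
    by (intro tendsto_intros conv lim)
  ultimately have "defect u \<le> b * (0 + ratio * (defect u + 0))"
    by (intro LIMSEQ_le_const[where a = "defect u"]) (assumption, simp)
  then have "(1 - b * ratio) * defect u \<le> 0"
    by (simp add: algebra_simps)
  then have "defect u \<le> 0"
    using b_ratio_less_1 by (simp add: mult_le_0_iff)
  then have "defect u = 0"
    using defect_nonneg[OF u] by simp
  then show ?thesis
    using u fixed_point_iff by blast
qed

section \<open>Convergence of k-step iterations\<close>

context
  fixes x :: "nat \<Rightarrow> 'a"
  assumes init: "\<And>i. i \<in> {1..k} \<Longrightarrow> x i \<in> X"
    and recurrence: "\<And>n. 1 \<le> n \<Longrightarrow> x (n + k) = f (map x [n..<n + k])"
begin

lemma seq_in: "1 \<le> n \<Longrightarrow> x n \<in> X"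
proof (induction n rule: less_induct)
  case (less n)
  show ?case
  proof (cases "n \<le> k")
    case False
    have "map x [n - k..<n] \<in> tuples X k"
      using less.IH False by (auto simp: tuples_def)
    then show ?thesis
      using recurrence[of "n - k"] False f_in by simp
  qed (use init less.prems in auto)
qed

lemma window_in: "1 \<le> n \<Longrightarrow> map x [n..<n + k] \<in> tuples X k"
  using seq_in by (auto simp: tuples_def)

lemma defect_seq_step:
  assumes "1 \<le> n" and C: "\<And>i. n \<le> i \<Longrightarrow> i < n + k \<Longrightarrow> defect (x i) \<le> C"
  shows "defect (x (n + k)) \<le> ratio * C"
proof (rule absorb_max)
  have "d (f (map x [n..<n + k])) (diag (x (n + k))) \<le> ratio * max C (defect (x (n + k)))"
    unfolding diag_def using assms seq_in
    by (intro image_dist_le window_in replicate_in_tuples)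
      (auto split: if_splits intro: le_max_iff_disj[THEN iffD2])
  then show "defect (x (n + k)) \<le> ratio * max C (defect (x (n + k)))"
    using recurrence[OF assms(1)] by (simp add: defect_def)
  show "0 \<le> C"
    using C[of n] defect_nonneg[OF seq_in[OF assms(1)]] k_ge_1 by simp
qed

text \<open>Every block of \<open>k\<close> indices gains one factor \<open>ratio\<close>.\<close>

lemma defect_seq_le:
  assumes C: "\<And>i. i \<in> {1..k} \<Longrightarrow> defect (x i) \<le> C"
  shows "m * k < n \<Longrightarrow> defect (x n) \<le> ratio ^ m * C"
proof (induction m arbitrary: n)
  case 0
  have C0: "0 \<le> C"
    using C[of 1] defect_nonneg[OF seq_in[of 1]] k_ge_1 by simp
  have "1 \<le> n \<Longrightarrow> defect (x n) \<le> C"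
  proof (induction n rule: less_induct)
    case (less n)
    show ?case
    proof (cases "n \<le> k")
      case False
      have "defect (x (n - k + k)) \<le> ratio * C"
        using less.IH False by (intro defect_seq_step) auto
      also have "\<dots> \<le> C"
        using C0 ratio_less_1 mult_right_mono[of ratio 1 C] by simp
      finally show ?thesis
        using False by simp
    qed (use C less.prems in auto)
  qed
  then show ?case
    using 0 by simp
next
  case (Suc m)
  have "k < n" "m * k < n - k"
    using Suc.prems by auto
  then have "defect (x (n - k + k)) \<le> ratio * (ratio ^ m * C)"
    using Suc.IH by (intro defect_seq_step) auto
  then show ?case
    using \<open>k < n\<close> by (simp add: mult.assoc)
qed

lemma seq_converges:
  assumes u: "fixed_point X k f u"
  shows "b_converges d x u"
  unfolding b_converges_def
proof (rule LIMSEQ_I)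
  fix e :: real assume e: "0 < e"
  have uX: "u \<in> X" and u0: "defect u = 0"
    using u by (simp_all add: fixed_point_iff)
  have fu: "f (replicate k u) = u"
    using u by (simp add: fixed_point_def)
  define C where "C = Max ((\<lambda>i. defect (x i)) ` {1..k})"
  have C: "defect (x i) \<le> C" if "i \<in> {1..k}" for i
    unfolding C_def using that by (intro Max_ge) auto
  obtain m where m: "ratio ^ m * C < e"
    using order_tendstoD(2)[OF ratio_power_tendsto_0 e] by (auto simp: eventually_sequentially)
  have small: "defect (x n) < e" if "m * k < n" for n
    using defect_seq_le[OF C that] m by simp
  have "norm (d (x n) u - 0) < e" if "n \<ge> m * k + k + 1" for n
  proof -
    define j where "j = n - k"
    have j: "n = j + k" "1 \<le> j" "m * k < j"
      using that by (auto simp: j_def)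
    have "d (f (map x [j..<j + k])) (f (replicate k u)) \<le> ratio * e"
      using small j uX u0 e
      by (intro image_dist_le window_in replicate_in_tuples)
        (auto split: if_splits intro!: less_imp_le)
    also have "\<dots> < e"
      using e ratio_less_1 by simp
    finally have "d (x n) u < e"
      using recurrence[OF j(2)] fu j(1) by simp
    then show ?thesis
      using nonneg[OF seq_in uX, of n] that by simp
  qed
  then show "\<exists>N. \<forall>n\<ge>N. norm (d (x n) u - 0) < e"
    by blast
qed

end

end

section \<open>The fixed point theorem\<close>

theorem theorem6:
  fixes X :: "'a set" and d :: "'a \<Rightarrow> 'a \<Rightarrow> real" and b a :: real
    and k :: nat and f :: "'a list \<Rightarrow> 'a"
  assumes "b_metric_space X d b"
    and "b_complete X d"
    and "1 \<le> k"
    and "f \<in> tuples X k \<rightarrow> X"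
    and "0 \<le> a * real k * b ^ (k + 1)" and "a * real k * b ^ (k + 1) < 1"
    and "\<forall>xs \<in> tuples X (k + 1).
           d (f (take k xs)) (f (drop 1 xs))
             \<le> a * Max ((\<lambda>i. d (xs ! (i - 1)) (f (replicate k (xs ! (i - 1))))) ` {1..k + 1})"
  shows "(\<exists>!u. fixed_point X k f u) \<and>
         (\<forall>u. fixed_point X k f u \<longrightarrow>
           (\<forall>x :: nat \<Rightarrow> 'a.
              (\<forall>i\<in>{1..k}. x i \<in> X) \<and> (\<forall>n\<ge>1. x (n + k) = f (map x [n..<n + k]))
              \<longrightarrow> b_converges d x u))"
proof -
  interpret b_metric_space X d b by fact
  have b: "0 < b"
    using param_ge_1 by simp
  interpret presic_kannan_map X d b k a f
  proof
    have "0 < real k * b ^ (k + 1)"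
      using b \<open>1 \<le> k\<close> by simp
    then show "0 \<le> a"
      using assms(5) by (simp add: mult.assoc zero_le_mult_iff)
    fix xs M
    assume xs: "xs \<in> tuples X (k + 1)"
      and M: "\<And>y. y \<in> set xs \<Longrightarrow> d y (f (replicate k y)) \<le> M"
    have "Max ((\<lambda>i. d (xs ! (i - 1)) (f (replicate k (xs ! (i - 1))))) ` {1..k + 1}) \<le> M"
      using xs M by (subst Max_le_iff) (auto simp: tuples_def intro!: M nth_mem)
    then show "d (f (take k xs)) (f (drop 1 xs)) \<le> a * M"
      by (rule order_trans[OF bspec[OF assms(7) xs] mult_left_mono[OF _ \<open>0 \<le> a\<close>]])
  qed (use assms in auto)
  obtain x0 where x0: "x0 \<in> X"
    using nonempty by blast
  have "\<exists>u. fixed_point X k f u"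
    by (rule fixed_point_exists_if_defect_tendsto_0[OF assms(2) picard_defect_tendsto_0[OF x0]])
  then have "\<exists>!u. fixed_point X k f u"
    using fixed_point_unique by blast
  moreover have "b_converges d x u"
    if "fixed_point X k f u"
      and "(\<forall>i\<in>{1..k}. x i \<in> X) \<and> (\<forall>n\<ge>1. x (n + k) = f (map x [n..<n + k]))" for u x
    using that by (intro seq_converges) auto
  ultimately show ?thesis
    by blast
qed

end
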